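(* Let $(X_k^\diamond,U_k^\diamond)_{k\ge0}$ be the trajectory of $X_{k+1}=AX_k+BU_k+EW_k$, $X_0=X_{\mathrm{ini}}$, under $U_k^\diamond=KX_k^\diamond+F\,\mathbb E[W]$, and let $(\bar X_k^\diamond,\bar U_k^\diamond)_{k\ge0}$ be a corresponding stationary trajectory with law $(\mu_X^\diamond,\mu_U^\diamond)$. Then there exist constants $\beta>0$ and $p\in[0,1)$ such that for all $k\ge0$ $$\big\|(X_k^\diamond,U_k^\diamond)-(\bar X_k^\diamond,\bar U_k^\diamond)\big\|\le\beta p^k,$$ where $\|\cdot\|$ is the $\mathcal L^2$-norm $\|Z\|=\sqrt{\mathbb E[Z^\top Z]}$. Consequently, for every $\varepsilon>0$, $$\mathbb P\Big(\limsup_{k\to\infty}\big\{\|(X_k^\diamond,U_k^\diamond)-(\bar X_k^\diamond,\bar U_k^\diamond)\|_2\ge\varepsilon\big\}\Big)=0,$$ where $\|\cdot\|_2$ is the Euclidean norm applied pathwise.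
   Context: $A\in\mathbb R^{n_x\times n_x}$, $B\in\mathbb R^{n_x\times n_u}$, $E\in\mathbb R^{n_x\times n_w}$; $Q\succeq0$, $R\succ0$; $(A,B)$ stabilizable, $(A,Q^{1/2})$ detectable. $X_{\mathrm{ini}}$ square integrable; $W_0,W_1,\dots$ i.i.d. square integrable, independent of $X_{\mathrm{ini}}$, distributed as $W$. Stationary quantities: $P$ stabilizing positive semidefinite solution of $P=Q+A^\top(P-PB(R+B^\top PB)^{-1}B^\top P)A$; $K=-(R+B^\top PB)^{-1}B^\top PA$; $\tilde A=A+BK$ (Schur stable); $G$ the unique solution of $G=\tilde A^\top(PE+G)$; $F=-(R+B^\top PB)^{-1}B^\top(PE+G)$; $\tilde F=BF+E$. Let $X_\infty:=(I-\tilde A)^{-1}\tilde F\mathbb E[W]+\sum_{j=0}^\infty\tilde A^jE(W'_j-\mathbb E[W])$ for i.i.d. copies $W'_j$ of $W$, and let $(\mu_X^\diamond,\mu_U^\diamond)$ denote the joint law of $(X_\infty,KX_\infty+F\mathbb E[W])$. A corresponding stationary trajectory with law $(\mu_X^\diamond,\mu_U^\diamond)$ is a sequence of square-integrable $(\bar X_k,\bar U_k)$ with $\bar X_{k+1}=A\bar X_k+B\bar U_k+EW_k$ (driven by the same disturbances $W_k$), $\bar X_0=\bar X_{\mathrm{ini}}$ for some square-integrable $\bar X_{\mathrm{ini}}$, and $(\bar X_k,\bar U_k)$ having joint law $(\mu_X^\diamond,\mu_U^\diamond)$ for all $k$. *)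

theory Defs
  imports "HOL-Probability.Probability"
begin

(* Matrices are real^'m^'n (rows indexed by 'n); dimensions are type variables. *)

definition psd_mat :: "real^'n^'n \<Rightarrow> bool" where
  "psd_mat P \<longleftrightarrow> transpose P = P \<and> (\<forall>x. 0 \<le> x \<bullet> (P *v x))"

definition pd_mat :: "real^'n^'n \<Rightarrow> bool" where
  "pd_mat P \<longleftrightarrow> transpose P = P \<and> (\<forall>x. x \<noteq> 0 \<longrightarrow> 0 < x \<bullet> (P *v x))"

definition cmat :: "real^'m^'n \<Rightarrow> complex^'m^'n" where
  "cmat A = (\<chi> i j. complex_of_real (A $ i $ j))"

text \<open>Schur stability: every (complex) eigenvalue has modulus < 1.\<close>
definition schur_stable :: "real^'n^'n \<Rightarrow> bool" where
  "schur_stable A \<longleftrightarrow>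
     (\<forall>(l::complex) (v::complex^'n). v \<noteq> 0 \<and> cmat A *v v = l *s v \<longrightarrow> cmod l < 1)"

definition stabilizable :: "real^'n^'n \<Rightarrow> real^'m^'n \<Rightarrow> bool" where
  "stabilizable A B \<longleftrightarrow> (\<exists>K :: real^'n^'m. schur_stable (A + B ** K))"

definition detectable :: "real^'n^'n \<Rightarrow> real^'n^'p \<Rightarrow> bool" where
  "detectable A C \<longleftrightarrow> (\<exists>L :: real^'p^'n. schur_stable (A + L ** C))"

fun mat_pow :: "real^'n^'n \<Rightarrow> nat \<Rightarrow> real^'n^'n" where
  "mat_pow A 0 = mat 1"
| "mat_pow A (Suc j) = A ** mat_pow A j"

text \<open>X_infinity as a function of a sequence w of i.i.d. copies of W:
  (I - At)^{-1} Ft m + sum_j At^j E (w_j - m), where m = E[W].\<close>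
definition X_inf :: "real^'n^'n \<Rightarrow> real^'w^'n \<Rightarrow> real^'w^'n \<Rightarrow> real^'w
                      \<Rightarrow> (nat \<Rightarrow> real^'w) \<Rightarrow> real^'n" where
  "X_inf At Ft E m w = matrix_inv (mat 1 - At) *v (Ft *v m)
                       + (\<Sum>j. mat_pow At j *v (E *v (w j - m)))"

text \<open>The stationary joint law (mu_X, mu_U): law of (X_inf, K X_inf + F m) where the
  copies W'_j are i.i.d. with law muW (realised on the countable product space).\<close>
definition mu_diamond :: "real^'n^'n \<Rightarrow> real^'w^'n \<Rightarrow> real^'w^'n \<Rightarrow> real^'n^'u
      \<Rightarrow> real^'w^'u \<Rightarrow> real^'w \<Rightarrow> (real^'w) measure \<Rightarrow> ((real^'n) \<times> (real^'u)) measure" where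
  "mu_diamond At Ft E K F m muW =
     distr (Pi\<^sub>M (UNIV :: nat set) (\<lambda>_. muW)) borel
       (\<lambda>w. (X_inf At Ft E m w, K *v X_inf At Ft E m w + F *v m))"

end

theory Submission
  imports Defs "Jordan_Normal_Form.Spectral_Radius"
begin

(* The stationary pair satisfies Ub k = K Xb k + F E[W] almost surely, because its law
   is the image of a map of exactly that shape. Both trajectories are driven by the same
   disturbances and use the same affine feedback, so their difference D k = Xd k - Xb k obeys the
   noise-free closed-loop recursion D (k+1) = (A + B K) D k pathwise, hence
   D k = (A + B K)^k D 0. Schur stability of A + B K yields |(A + B K)^k| <= C p^k with p < 1,
   which bounds the L2 distance by a multiple of p^k and makes the deviation tend to 0 almost
   surely, so that the limsup of the deviation events is a null set. *)

no_notation Matrix.vec_index (infixl "$" 100)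

section \<open>Geometric decay of the powers of a Schur stable matrix\<close>

definition cart_index :: "nat \<Rightarrow> 'n::finite" where
  "cart_index = (SOME f. bij_betw f {..<CARD('n)} UNIV)"

lemma bij_betw_cart_index: "bij_betw (cart_index :: nat \<Rightarrow> 'n::finite) {..<CARD('n)} UNIV"
proof -
  obtain h :: "nat \<Rightarrow> 'n" where "bij_betw h {0..<CARD('n)} UNIV"
    using ex_bij_betw_nat_finite[of "UNIV :: 'n set"] by auto
  then have "\<exists>f. bij_betw (f :: nat \<Rightarrow> 'n) {..<CARD('n)} UNIV"
    by (auto simp: lessThan_atLeast0)
  then show ?thesis
    unfolding cart_index_def by (rule someI_ex)
qed

lemma cart_index_eq_iff:
  "i < CARD('n) \<Longrightarrow> j < CARD('n) \<Longrightarrow> (cart_index i :: 'n::finite) = cart_index j \<longleftrightarrow> i = j"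
  using bij_betw_cart_index[where 'n='n] unfolding bij_betw_def inj_on_def by auto

lemma cart_index_surj: obtains i where "i < CARD('n)" "cart_index i = (a :: 'n::finite)"
  using bij_betw_cart_index[where 'n='n] unfolding bij_betw_def by (metis UNIV_I imageE lessThan_iff)

lemma sum_UNIV_cart_index: "(\<Sum>a\<in>UNIV. g a) = (\<Sum>i<CARD('n). g (cart_index i :: 'n::finite))"
  using sum.reindex_bij_betw[OF bij_betw_cart_index[where 'n='n], of g] by simp

(* Transfer to Jordan_Normal_Form, where the powers of a complex matrix of spectral radius
   less than 1 are known to be bounded. *)
definition complex_mat_of :: "real^'n^'n \<Rightarrow> complex mat" where
  "complex_mat_of X =
     Matrix.mat CARD('n) CARD('n) (\<lambda>(i, j). complex_of_real (X $ cart_index i $ cart_index j))"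

lemma complex_mat_of_carrier: "complex_mat_of (X :: real^'n^'n) \<in> carrier_mat CARD('n) CARD('n)"
  unfolding complex_mat_of_def by simp

lemma dim_row_complex_mat_of [simp]: "dim_row (complex_mat_of (X :: real^'n^'n)) = CARD('n)"
  unfolding complex_mat_of_def by simp

lemma complex_mat_of_mult: "complex_mat_of (X ** Y) = complex_mat_of X * complex_mat_of (Y :: real^'n^'n)"
proof (rule eq_matI)
  fix i j assume "i < dim_row (complex_mat_of X * complex_mat_of Y)"
    and "j < dim_col (complex_mat_of X * complex_mat_of Y)"
  then have i: "i < CARD('n)" and j: "j < CARD('n)"
    by (auto simp: complex_mat_of_def)
  have "(complex_mat_of X * complex_mat_of Y) $$ (i, j)
      = (\<Sum>l<CARD('n). complex_of_real (X $ cart_index i $ cart_index l * Y $ cart_index l $ cart_index j))"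
    using i j by (simp add: scalar_prod_def complex_mat_of_def lessThan_atLeast0)
  also have "\<dots> = complex_of_real (\<Sum>c\<in>UNIV. X $ cart_index i $ c * Y $ c $ cart_index j)"
    by (simp add: sum_UNIV_cart_index[of "\<lambda>c. X $ cart_index i $ c * Y $ c $ cart_index j"])
  also have "\<dots> = complex_mat_of (X ** Y) $$ (i, j)"
    using i j by (simp add: complex_mat_of_def matrix_matrix_mult_def)
  finally show "complex_mat_of (X ** Y) $$ (i, j) = (complex_mat_of X * complex_mat_of Y) $$ (i, j)"
    by simp
qed (auto simp: complex_mat_of_def)

lemma complex_mat_of_one: "complex_mat_of (Finite_Cartesian_Product.mat 1 :: real^'n^'n) = 1\<^sub>m CARD('n)"
  by (rule eq_matI) (auto simp: complex_mat_of_def Finite_Cartesian_Product.mat_def cart_index_eq_iff)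

lemma mat_pow_Suc_right: "mat_pow X (Suc k) = mat_pow X k ** X"
  by (induction k) (simp_all add: matrix_mul_assoc)

lemma complex_mat_of_mat_pow: "complex_mat_of (mat_pow (X :: real^'n^'n) k) = complex_mat_of X ^\<^sub>m k"
proof (induction k)
  case 0
  then show ?case
    by (simp add: complex_mat_of_one)
next
  case (Suc k)
  then show ?case
    by (simp only: mat_pow_Suc_right complex_mat_of_mult pow_mat.simps)
qed

lemma mat_pow_scaleR: "mat_pow (c *\<^sub>R (X :: real^'n^'n)) k = c ^ k *\<^sub>R mat_pow X k"
  by (induction k)
    (simp_all add: Finite_Cartesian_Product.vec_eq_iff matrix_matrix_mult_def scaleR_sum_right
      sum_distrib_left mult_ac)

lemma cmat_scaleR_mult_vec: "cmat (c *\<^sub>R (X :: real^'n^'m)) *v w = complex_of_real c *s (cmat X *v w)"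
  by (simp add: Finite_Cartesian_Product.vec_eq_iff matrix_vector_mult_def cmat_def sum_distrib_left
      mult_ac)

definition vec_of_cart :: "complex^'n \<Rightarrow> complex Matrix.vec" where
  "vec_of_cart w = Matrix.vec CARD('n) (\<lambda>i. w $ cart_index i)"

lemma vec_of_cart_carrier: "vec_of_cart (w :: complex^'n) \<in> carrier_vec CARD('n)"
  unfolding vec_of_cart_def by simp

lemma vec_of_cart_inject: "vec_of_cart w = vec_of_cart w' \<longleftrightarrow> w = (w' :: complex^'n)"
proof
  assume eq: "vec_of_cart w = vec_of_cart w'"
  show "w = w'"
  proof (subst Finite_Cartesian_Product.vec_eq_iff, rule allI)
    fix a :: 'n
    obtain i where "i < CARD('n)" "cart_index i = a"
      by (rule cart_index_surj)
    then show "w $ a = w' $ a"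
      using arg_cong[OF eq, of "\<lambda>v. vec_index v i"] by (simp add: vec_of_cart_def)
  qed
qed simp

lemma vec_of_cart_surj:
  assumes "v \<in> carrier_vec CARD('n)"
  obtains w :: "complex^'n" where "v = vec_of_cart w"
proof
  show "v = vec_of_cart (\<chi> a :: 'n. vec_index v (inv_into {..<CARD('n)} cart_index a))"
    using assms bij_betw_cart_index[where 'n='n]
    by (auto simp: vec_of_cart_def bij_betw_inv_into_left)
qed

lemma vec_of_cart_zero: "vec_of_cart (0 :: complex^'n) = 0\<^sub>v CARD('n)"
  by (auto simp: vec_of_cart_def)

lemma vec_of_cart_smult: "vec_of_cart (l *s w) = l \<cdot>\<^sub>v vec_of_cart w"
  by (auto simp: vec_of_cart_def)

lemma complex_mat_of_mult_vec_of_cart: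
  "complex_mat_of (X :: real^'n^'n) *\<^sub>v vec_of_cart w = vec_of_cart (cmat X *v w)"
proof (rule eq_vecI)
  fix i assume "i < dim_vec (vec_of_cart (cmat X *v w))"
  then have i: "i < CARD('n)"
    by (simp add: vec_of_cart_def)
  have "vec_index (complex_mat_of X *\<^sub>v vec_of_cart w) i
      = (\<Sum>j<CARD('n). complex_of_real (X $ cart_index i $ cart_index j) * w $ cart_index j)"
    using i by (simp add: complex_mat_of_def vec_of_cart_def scalar_prod_def lessThan_atLeast0)
  also have "\<dots> = vec_index (vec_of_cart (cmat X *v w)) i"
    using i unfolding matrix_vector_mult_def cmat_def
    by (simp add: vec_of_cart_def sum_UNIV_cart_index[where 'n='n])
  finally show "vec_index (complex_mat_of X *\<^sub>v vec_of_cart w) i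
      = vec_index (vec_of_cart (cmat X *v w)) i" .
qed (simp add: complex_mat_of_def vec_of_cart_def)

lemma eigenvalue_complex_mat_of_iff:
  "eigenvalue (complex_mat_of (X :: real^'n^'n)) l \<longleftrightarrow> (\<exists>w. w \<noteq> 0 \<and> cmat X *v w = l *s w)"
proof
  assume "eigenvalue (complex_mat_of X) l"
  then obtain v where v: "v \<in> carrier_vec CARD('n)" "v \<noteq> 0\<^sub>v CARD('n)"
      "complex_mat_of X *\<^sub>v v = l \<cdot>\<^sub>v v"
    unfolding eigenvalue_def eigenvector_def by (auto simp: complex_mat_of_def)
  obtain w :: "complex^'n" where v_eq: "v = vec_of_cart w"
    using v(1) by (rule vec_of_cart_surj)
  have "w \<noteq> 0"
    using v(2) unfolding v_eq by (auto simp: vec_of_cart_zero)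
  moreover have "vec_of_cart (cmat X *v w) = vec_of_cart (l *s w)"
    using v(3) unfolding v_eq complex_mat_of_mult_vec_of_cart vec_of_cart_smult .
  ultimately show "\<exists>w. w \<noteq> 0 \<and> cmat X *v w = l *s w"
    unfolding vec_of_cart_inject by blast
next
  assume "\<exists>w. w \<noteq> 0 \<and> cmat X *v w = l *s w"
  then obtain w where w: "w \<noteq> 0" "cmat X *v w = l *s w"
    by blast
  have "vec_of_cart w \<noteq> 0\<^sub>v CARD('n)"
    using w(1) vec_of_cart_inject[of w 0] by (simp add: vec_of_cart_zero)
  moreover have "complex_mat_of X *\<^sub>v vec_of_cart w = l \<cdot>\<^sub>v vec_of_cart w"
    by (simp add: complex_mat_of_mult_vec_of_cart w(2) vec_of_cart_smult)
  ultimately show "eigenvalue (complex_mat_of X) l"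
    unfolding eigenvalue_def eigenvector_def using vec_of_cart_carrier by auto
qed

lemma eigenvalue_norm_le_spectral_radius:
  assumes "w \<noteq> 0" "cmat (X :: real^'n^'n) *v w = l *s w"
  shows "cmod l \<le> spectral_radius (complex_mat_of X)"
proof -
  have "eigenvalue (complex_mat_of X) l"
    using assms eigenvalue_complex_mat_of_iff by blast
  then show ?thesis
    using spectral_radius_mem_max(2)[OF complex_mat_of_carrier[of X] zero_less_card_finite]
    unfolding spectrum_def by blast
qed

lemma spectral_radius_eigenvalue:
  obtains l w where "w \<noteq> 0" "cmat (X :: real^'n^'n) *v w = l *s w"
    "cmod l = spectral_radius (complex_mat_of X)"
  using spectral_radius_mem_max(1)[OF complex_mat_of_carrier[of X] zero_less_card_finite]
  by (auto simp: spectrum_def eigenvalue_complex_mat_of_iff)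

lemma spectral_radius_complex_mat_of_nonneg: "0 \<le> spectral_radius (complex_mat_of (X :: real^'n^'n))"
proof -
  obtain l w where "w \<noteq> 0" "cmat X *v w = l *s w" "cmod l = spectral_radius (complex_mat_of X)"
    by (rule spectral_radius_eigenvalue)
  then show ?thesis
    using norm_ge_zero[of l] by simp
qed

lemma schur_stable_iff_spectral_radius:
  "schur_stable (X :: real^'n^'n) \<longleftrightarrow> spectral_radius (complex_mat_of X) < 1"
proof
  assume stable: "schur_stable X"
  obtain l w where "w \<noteq> 0" "cmat X *v w = l *s w" "cmod l = spectral_radius (complex_mat_of X)"
    by (rule spectral_radius_eigenvalue)
  moreover from stable this(1,2) have "cmod l < 1"
    unfolding schur_stable_def by blast
  ultimately show "spectral_radius (complex_mat_of X) < 1"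
    by simp
next
  assume "spectral_radius (complex_mat_of X) < 1"
  then show "schur_stable X"
    unfolding schur_stable_def using eigenvalue_norm_le_spectral_radius le_less_trans by blast
qed

lemma schur_stable_scaleR_inverse:
  assumes "spectral_radius (complex_mat_of (X :: real^'n^'n)) < p"
  shows "schur_stable ((1 / p) *\<^sub>R X)"
  unfolding schur_stable_def
proof (intro allI impI, elim conjE)
  fix l w assume w: "w \<noteq> 0" "cmat ((1 / p) *\<^sub>R X) *v w = l *s w"
  have p: "0 < p"
    using assms spectral_radius_complex_mat_of_nonneg[of X] by linarith
  have "cmat X *v w = complex_of_real p *s (cmat ((1 / p) *\<^sub>R X) *v w)"
    using p by (simp add: cmat_scaleR_mult_vec vector_smult_assoc)
  also have "\<dots> = (complex_of_real p * l) *s w"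
    using w(2) by (simp add: vector_smult_assoc)
  finally have "cmod (complex_of_real p * l) \<le> spectral_radius (complex_mat_of X)"
    by (rule eigenvalue_norm_le_spectral_radius[OF w(1)])
  then have "p * cmod l \<le> spectral_radius (complex_mat_of X)"
    using p by (simp add: norm_mult)
  then have "p * cmod l < p * 1"
    using assms by linarith
  then show "cmod l < 1"
    using p by (simp add: mult_less_cancel_left)
qed

lemma schur_stable_mat_pow_bounded:
  assumes "schur_stable (X :: real^'n^'n)"
  obtains c where "\<And>k. onorm ((*v) (mat_pow X k)) \<le> c"
proof -
  obtain c where c: "\<And>k. norm_bound (complex_mat_of X ^\<^sub>m k) c"
    using spectral_radius_jnf_norm_bound_less_1_upper_triangular[OF complex_mat_of_carrier]
      assms[unfolded schur_stable_iff_spectral_radius] by blast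
  have "\<bar>mat_pow X k $ a $ b\<bar> \<le> c" for k a b
  proof -
    obtain i j where "i < CARD('n)" "cart_index i = a" "j < CARD('n)" "cart_index j = b"
      by (metis cart_index_surj)
    then show ?thesis
      using c[of k] unfolding complex_mat_of_mat_pow[symmetric] norm_bound_def
      by (auto simp: complex_mat_of_def)
  qed
  then show ?thesis
    using that onorm_le_matrix_component by blast
qed

lemma schur_stable_mat_pow_decay:
  assumes "schur_stable (X :: real^'n^'n)"
  obtains C p where "0 \<le> C" "0 < p" "p < 1" "\<And>k x. norm (mat_pow X k *v x) \<le> C * p ^ k * norm x"
proof -
  \<comment> \<open>Rescaling by 1/p with spectral radius < p < 1 turns boundedness of powers into decay like p^k.\<close>
  define p where "p = (1 + spectral_radius (complex_mat_of X)) / 2"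
  have "0 \<le> spectral_radius (complex_mat_of X)"
    by (rule spectral_radius_complex_mat_of_nonneg)
  moreover have "spectral_radius (complex_mat_of X) < 1"
    using assms schur_stable_iff_spectral_radius by blast
  ultimately have p: "0 < p" "p < 1" "spectral_radius (complex_mat_of X) < p"
    unfolding p_def by auto
  obtain C where C: "\<And>k. onorm ((*v) (mat_pow ((1 / p) *\<^sub>R X) k)) \<le> C"
    using schur_stable_mat_pow_bounded[OF schur_stable_scaleR_inverse[OF p(3)]] by blast
  have "norm (mat_pow X k *v x) \<le> C * p ^ k * norm x" for k x
  proof -
    have "mat_pow X k = p ^ k *\<^sub>R mat_pow ((1 / p) *\<^sub>R X) k"
      using p(1) by (simp add: mat_pow_scaleR power_one_over)
    then have "norm (mat_pow X k *v x) = p ^ k * norm (mat_pow ((1 / p) *\<^sub>R X) k *v x)"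
      using p(1) by (simp add: scaleR_matrix_vector_assoc[symmetric])
    also have "\<dots> \<le> p ^ k * (C * norm x)"
    proof (rule mult_left_mono)
      have "norm (mat_pow ((1 / p) *\<^sub>R X) k *v x) \<le> onorm ((*v) (mat_pow ((1 / p) *\<^sub>R X) k)) * norm x"
        by (rule onorm[OF matrix_vector_mul_bounded_linear])
      also have "\<dots> \<le> C * norm x"
        by (rule mult_right_mono[OF C]) simp
      finally show "norm (mat_pow ((1 / p) *\<^sub>R X) k *v x) \<le> C * norm x" .
    qed (use p in simp)
    finally show ?thesis
      by (simp add: mult_ac)
  qed
  moreover have "0 \<le> C"
    using C[of 0] onorm_pos_le[OF matrix_vector_mul_bounded_linear] by (meson order_trans)
  ultimately show ?thesis
    using that p by blast
qed

section \<open>The stationary feedback law\<close>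

lemma closed_affine_graph:
  "closed {z :: (real^'n) \<times> (real^'u). snd z = (K :: real^'n^'u) *v fst z + c}"
  by (intro closed_Collect_eq continuous_intros
      bounded_linear.continuous_on[OF matrix_vector_mul_bounded_linear])

lemma AE_mu_diamond_feedback:
  fixes K :: "real^'n^'u" and F :: "real^'w^'u"
  shows "AE z in mu_diamond At Ft E K F m \<mu>. snd z = K *v fst z + F *v m"
proof -
  define S where "S = {z :: (real^'n) \<times> (real^'u). snd z \<noteq> K *v fst z + F *v m}"
  have "S \<in> sets (mu_diamond At Ft E K F m \<mu>)"
    using closed_affine_graph[of K "F *v m"] unfolding S_def mu_diamond_def
    by (simp add: open_Collect_neg closed_def Collect_neg_eq[symmetric])
  \<comment> \<open>Every value of the map defining mu_diamond lies on the graph, so the preimage of S is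
    empty; this needs no measurability of X_inf.\<close>
  moreover have "emeasure (mu_diamond At Ft E K F m \<mu>) S = 0"
    unfolding mu_diamond_def distr_def emeasure_measure_of_conv by (simp add: S_def)
  ultimately have "S \<in> null_sets (mu_diamond At Ft E K F m \<mu>)"
    by blast
  then show ?thesis
    by (rule AE_I') (auto simp: S_def)
qed

lemma AE_feedback_if_distr_eq_mu_diamond:
  fixes K :: "real^'n^'u" and F :: "real^'w^'u"
  assumes "(\<lambda>\<omega>. (X \<omega>, U \<omega>)) \<in> borel_measurable M"
    and "distr M borel (\<lambda>\<omega>. (X \<omega>, U \<omega>)) = mu_diamond At Ft E K F m \<mu>"
  shows "AE \<omega> in M. U \<omega> = K *v X \<omega> + F *v m"
proof -
  have "{z \<in> space borel. snd z = K *v fst z + F *v m} \<in> sets borel"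
    using closed_affine_graph[of K "F *v m"] by simp
  moreover have "AE z in distr M borel (\<lambda>\<omega>. (X \<omega>, U \<omega>)). snd z = K *v fst z + F *v m"
    unfolding assms(2) by (rule AE_mu_diamond_feedback)
  ultimately show ?thesis
    using AE_distr_iff[OF assms(1)] by simp
qed

section \<open>Deviation of two closed-loop trajectories\<close>

lemma closed_loop_deviation:
  fixes A :: "real^'n^'n" and B :: "real^'u^'n" and K :: "real^'n^'u"
  assumes "\<And>k. x (Suc k) = A *v x k + B *v u k + e k"
    and "\<And>k. y (Suc k) = A *v y k + B *v v k + e k"
    and "\<And>k. u k - v k = K *v (x k - y k)"
  shows "x k - y k = mat_pow (A + B ** K) k *v (x 0 - y 0)"
proof (induction k)
  case 0
  then show ?case
    by simp
next
  case (Suc k)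
  have "x (Suc k) - y (Suc k) = A *v (x k - y k) + B *v (u k - v k)"
    unfolding assms(1,2) by (simp add: matrix_vector_mult_diff_distrib)
  also have "\<dots> = (A + B ** K) *v (x k - y k)"
    unfolding assms(3) by (simp add: matrix_vector_mult_add_rdistrib matrix_vector_mul_assoc)
  also have "\<dots> = mat_pow (A + B ** K) (Suc k) *v (x 0 - y 0)"
    unfolding Suc by (simp add: matrix_vector_mul_assoc)
  finally show ?case .
qed

lemma closed_loop_deviation_le:
  fixes A :: "real^'n^'n" and B :: "real^'u^'n" and K :: "real^'n^'u"
  assumes "\<And>k. x (Suc k) = A *v x k + B *v u k + e k"
    and "\<And>k. y (Suc k) = A *v y k + B *v v k + e k"
    and "\<And>k. u k - v k = K *v (x k - y k)"
    and decay: "\<And>k z. norm (mat_pow (A + B ** K) k *v z) \<le> C * p ^ k * norm z"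
  shows "norm ((x k, u k) - (y k, v k)) \<le> (1 + onorm ((*v) K)) * C * p ^ k * norm (x 0 - y 0)"
proof -
  have "norm ((x k, u k) - (y k, v k)) \<le> norm (x k - y k) + norm (K *v (x k - y k))"
    using norm_Pair_le[of "x k - y k" "u k - v k"] assms(3) by simp
  also have "\<dots> \<le> (1 + onorm ((*v) K)) * norm (x k - y k)"
    using onorm[OF matrix_vector_mul_bounded_linear, of K "x k - y k"] by (simp add: distrib_right)
  also have "\<dots> \<le> (1 + onorm ((*v) K)) * (C * p ^ k * norm (x 0 - y 0))"
  proof (rule mult_left_mono)
    show "norm (x k - y k) \<le> C * p ^ k * norm (x 0 - y 0)"
      by (subst closed_loop_deviation[where x = x and y = y and u = u and v = v, OF assms(1-3)])
        (rule decay)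
    show "0 \<le> 1 + onorm ((*v) K)"
      using onorm_pos_le[OF matrix_vector_mul_bounded_linear, of K] by simp
  qed
  finally show ?thesis
    by (simp add: mult_ac)
qed

section \<open>Consequences of a geometric pathwise bound\<close>

lemma integrable_power2_norm_diff:
  fixes X Y :: "'a \<Rightarrow> 'b::euclidean_space"
  assumes "X \<in> borel_measurable M" "Y \<in> borel_measurable M"
    and "integrable M (\<lambda>\<omega>. (norm (X \<omega>))\<^sup>2)" "integrable M (\<lambda>\<omega>. (norm (Y \<omega>))\<^sup>2)"
  shows "integrable M (\<lambda>\<omega>. (norm (X \<omega> - Y \<omega>))\<^sup>2)"
proof (rule Bochner_Integration.integrable_bound)
  show "integrable M (\<lambda>\<omega>. 2 * (norm (X \<omega>))\<^sup>2 + 2 * (norm (Y \<omega>))\<^sup>2)"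
    using assms(3,4) by simp
  show "(\<lambda>\<omega>. (norm (X \<omega> - Y \<omega>))\<^sup>2) \<in> borel_measurable M"
    using assms(1,2) by measurable
  show "AE \<omega> in M. norm ((norm (X \<omega> - Y \<omega>))\<^sup>2) \<le> norm (2 * (norm (X \<omega>))\<^sup>2 + 2 * (norm (Y \<omega>))\<^sup>2)"
  proof (rule AE_I2)
    fix \<omega>
    have "(norm (X \<omega> - Y \<omega>))\<^sup>2 \<le> (norm (X \<omega>) + norm (Y \<omega>))\<^sup>2"
      by (intro power_mono norm_triangle_ineq4) simp
    also have "\<dots> \<le> 2 * (norm (X \<omega>))\<^sup>2 + 2 * (norm (Y \<omega>))\<^sup>2"
      using zero_le_power2[of "norm (X \<omega>) - norm (Y \<omega>)"] unfolding power2_sum power2_diff by linarith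
    finally show "norm ((norm (X \<omega> - Y \<omega>))\<^sup>2) \<le> norm (2 * (norm (X \<omega>))\<^sup>2 + 2 * (norm (Y \<omega>))\<^sup>2)"
      by simp
  qed
qed

lemma (in prob_space) L2_norm_le_geometric:
  fixes Y :: "nat \<Rightarrow> 'a \<Rightarrow> 'b::real_normed_vector"
  assumes Z: "integrable M (\<lambda>\<omega>. (Z \<omega>)\<^sup>2)"
    and bound: "\<And>k. AE \<omega> in M. norm (Y k \<omega>) \<le> c * p ^ k * Z \<omega>"
    and "0 \<le> c" "0 \<le> p"
  shows "\<exists>\<beta>>0. \<forall>k. sqrt (expectation (\<lambda>\<omega>. (norm (Y k \<omega>))\<^sup>2)) \<le> \<beta> * p ^ k"
proof (intro exI conjI allI)
  define \<sigma> where "\<sigma> = sqrt (expectation (\<lambda>\<omega>. (Z \<omega>)\<^sup>2))"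
  have \<sigma>: "0 \<le> \<sigma>"
    unfolding \<sigma>_def by simp
  show "0 < c * \<sigma> + 1"
    using \<sigma> \<open>0 \<le> c\<close> by (simp add: add_nonneg_pos)
  fix k
  have "AE \<omega> in M. (norm (Y k \<omega>))\<^sup>2 \<le> (c * p ^ k)\<^sup>2 * (Z \<omega>)\<^sup>2"
    using bound[of k]
  proof eventually_elim
    case (elim \<omega>)
    then have "(norm (Y k \<omega>))\<^sup>2 \<le> (c * p ^ k * Z \<omega>)\<^sup>2"
      by (rule power_mono) simp
    then show ?case
      by (simp only: power_mult_distrib)
  qed
  then have "expectation (\<lambda>\<omega>. (norm (Y k \<omega>))\<^sup>2) \<le> expectation (\<lambda>\<omega>. (c * p ^ k)\<^sup>2 * (Z \<omega>)\<^sup>2)"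
    using Z by (intro integral_mono_AE') auto
  then have "sqrt (expectation (\<lambda>\<omega>. (norm (Y k \<omega>))\<^sup>2)) \<le> sqrt ((c * p ^ k)\<^sup>2 * \<sigma>\<^sup>2)"
    unfolding \<sigma>_def by simp
  also have "\<dots> = c * \<sigma> * p ^ k"
    using \<sigma> \<open>0 \<le> c\<close> \<open>0 \<le> p\<close> by (simp add: real_sqrt_mult mult_ac)
  also have "\<dots> \<le> (c * \<sigma> + 1) * p ^ k"
    using \<open>0 \<le> p\<close> by (simp add: mult_right_mono)
  finally show "sqrt (expectation (\<lambda>\<omega>. (norm (Y k \<omega>))\<^sup>2)) \<le> (c * \<sigma> + 1) * p ^ k" .
qed

lemma measure_limsup_eq_0_if_AE_tendsto:
  fixes Y :: "nat \<Rightarrow> 'a \<Rightarrow> 'b::real_normed_vector"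
  assumes "AE \<omega> in M. (\<lambda>k. Y k \<omega>) \<longlonglongrightarrow> 0" and "0 < \<epsilon>"
  shows "measure M (limsup (\<lambda>k. {\<omega> \<in> space M. \<epsilon> \<le> norm (Y k \<omega>)})) = 0"
proof -
  let ?S = "limsup (\<lambda>k. {\<omega> \<in> space M. \<epsilon> \<le> norm (Y k \<omega>)})"
  have "AE \<omega> in M. \<omega> \<notin> ?S"
    using assms(1)
  proof eventually_elim
    case (elim \<omega>)
    then have "(\<lambda>k. norm (Y k \<omega>)) \<longlonglongrightarrow> 0"
      by (rule tendsto_norm_zero)
    then have "\<forall>\<^sub>F k in sequentially. norm (Y k \<omega>) < \<epsilon>"
      using assms(2) by (rule order_tendstoD(2))
    then obtain n where "\<And>k. n \<le> k \<Longrightarrow> norm (Y k \<omega>) < \<epsilon>"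
      unfolding eventually_sequentially by blast
    then show "\<omega> \<notin> ?S"
      unfolding limsup_INF_SUP by (auto simp: not_le[symmetric])
  qed
  show ?thesis
  proof (cases "?S \<in> sets M")
    case True
    then show ?thesis
      using \<open>AE \<omega> in M. \<omega> \<notin> ?S\<close> by (simp add: AE_iff_null_sets measure_eq_0_null_sets)
  next
    case False
    then show ?thesis
      by (rule measure_notin_sets)
  qed
qed

lemma (in prob_space) L2_and_limsup_of_geometric_bound:
  fixes Y :: "nat \<Rightarrow> 'a \<Rightarrow> 'b::real_normed_vector"
  assumes Z: "integrable M (\<lambda>\<omega>. (Z \<omega>)\<^sup>2)"
    and bound: "AE \<omega> in M. \<forall>k. norm (Y k \<omega>) \<le> c * p ^ k * Z \<omega>"
    and "0 \<le> c" "0 \<le> p" "p < 1"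
  shows "(\<exists>\<beta>>0. \<exists>p. 0 \<le> p \<and> p < 1 \<and>
            (\<forall>k. sqrt (expectation (\<lambda>\<omega>. (norm (Y k \<omega>))\<^sup>2)) \<le> \<beta> * p ^ k))
       \<and> (\<forall>\<epsilon>>0. measure M (limsup (\<lambda>k. {\<omega> \<in> space M. norm (Y k \<omega>) \<ge> \<epsilon>})) = 0)"
proof (intro conjI allI impI)
  have "AE \<omega> in M. norm (Y k \<omega>) \<le> c * p ^ k * Z \<omega>" for k
    using bound by eventually_elim blast
  then obtain \<beta> where "\<beta> > 0" "\<forall>k. sqrt (expectation (\<lambda>\<omega>. (norm (Y k \<omega>))\<^sup>2)) \<le> \<beta> * p ^ k"
    using L2_norm_le_geometric[OF Z _ \<open>0 \<le> c\<close> \<open>0 \<le> p\<close>] by blast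
  with \<open>0 \<le> p\<close> \<open>p < 1\<close>
  show "\<exists>\<beta>>0. \<exists>p. 0 \<le> p \<and> p < 1 \<and> (\<forall>k. sqrt (expectation (\<lambda>\<omega>. (norm (Y k \<omega>))\<^sup>2)) \<le> \<beta> * p ^ k)"
    by blast
next
  fix \<epsilon> :: real
  assume "0 < \<epsilon>"
  have "(\<lambda>k. p ^ k) \<longlonglongrightarrow> 0"
    using \<open>0 \<le> p\<close> \<open>p < 1\<close> by (intro LIMSEQ_power_zero) simp
  then have bound_tendsto: "(\<lambda>k. c * p ^ k * z) \<longlonglongrightarrow> 0" for z
    by (intro tendsto_mult_right_zero tendsto_mult_left_zero)
  have "AE \<omega> in M. (\<lambda>k. Y k \<omega>) \<longlonglongrightarrow> 0"
    using bound
  proof eventually_elim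
    case (elim \<omega>)
    show ?case
      using always_eventually[OF elim] bound_tendsto by (rule Lim_null_comparison)
  qed
  then show "measure M (limsup (\<lambda>k. {\<omega> \<in> space M. norm (Y k \<omega>) \<ge> \<epsilon>})) = 0"
    using \<open>0 < \<epsilon>\<close> by (rule measure_limsup_eq_0_if_AE_tendsto)
qed

theorem lemma5:
  fixes A :: "real^'nx^'nx" and B :: "real^'nu^'nx" and E :: "real^'nw^'nx"
    and Q :: "real^'nx^'nx" and Qh :: "real^'nx^'nx" and R :: "real^'nu^'nu"
    and P :: "real^'nx^'nx" and K :: "real^'nx^'nu" and G :: "real^'nw^'nx"
    and F :: "real^'nw^'nu"
    and M :: "'a measure"
    and X_ini :: "'a \<Rightarrow> real^'nx" and W :: "nat \<Rightarrow> 'a \<Rightarrow> real^'nw"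
    and Xd :: "nat \<Rightarrow> 'a \<Rightarrow> real^'nx" and Ud :: "nat \<Rightarrow> 'a \<Rightarrow> real^'nu"
    and Xb :: "nat \<Rightarrow> 'a \<Rightarrow> real^'nx" and Ub :: "nat \<Rightarrow> 'a \<Rightarrow> real^'nu"
  assumes Q: "psd_mat Q" and R: "pd_mat R"
    and Qh: "psd_mat Qh" "Qh ** Qh = Q"
    and stab: "stabilizable A B" and det: "detectable A Qh"
    and P: "psd_mat P"
      "P = Q + transpose A ** (P - P ** B ** matrix_inv (R + transpose B ** P ** B)
                                   ** transpose B ** P) ** A"
    and K: "K = - (matrix_inv (R + transpose B ** P ** B) ** transpose B ** P ** A)"
    and P_stabilizing: "schur_stable (A + B ** K)"
    and G: "G = transpose (A + B ** K) ** (P ** E + G)"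
    and F: "F = - (matrix_inv (R + transpose B ** P ** B) ** transpose B ** (P ** E + G))"
    and M: "prob_space M"
    and X_ini_rv: "X_ini \<in> borel_measurable M"
    and X_ini_L2: "integrable M (\<lambda>\<omega>. (norm (X_ini \<omega>))\<^sup>2)"
    and W_rv: "\<And>k. W k \<in> borel_measurable M"
    and W_L2: "integrable M (\<lambda>\<omega>. (norm (W 0 \<omega>))\<^sup>2)"
    and W_ident: "\<And>k. distr M borel (W k) = distr M borel (W 0)"
    and indep: "prob_space.indep_sets M
        (\<lambda>i. case i of None \<Rightarrow> sets (vimage_algebra (space M) X_ini borel)
                       | Some k \<Rightarrow> sets (vimage_algebra (space M) (W k) borel))
        (UNIV :: nat option set)"
    and Xd0: "Xd 0 = X_ini"
    and Ud: "\<And>k \<omega>. Ud k \<omega> = K *v Xd k \<omega> + F *v prob_space.expectation M (W 0)"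
    and Xd: "\<And>k \<omega>. Xd (Suc k) \<omega> = A *v Xd k \<omega> + B *v Ud k \<omega> + E *v W k \<omega>"
    and Xb_rv: "\<And>k. Xb k \<in> borel_measurable M" "\<And>k. Ub k \<in> borel_measurable M"
    and Xb_L2: "\<And>k. integrable M (\<lambda>\<omega>. (norm (Xb k \<omega>))\<^sup>2)"
               "\<And>k. integrable M (\<lambda>\<omega>. (norm (Ub k \<omega>))\<^sup>2)"
    and Xb: "\<And>k \<omega>. Xb (Suc k) \<omega> = A *v Xb k \<omega> + B *v Ub k \<omega> + E *v W k \<omega>"
    and Xb_law: "\<And>k. distr M borel (\<lambda>\<omega>. (Xb k \<omega>, Ub k \<omega>)) =
        mu_diamond (A + B ** K) (B ** F + E) E K F (prob_space.expectation M (W 0))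
                   (distr M borel (W 0))"
  shows "(\<exists>\<beta>>0. \<exists>p. 0 \<le> p \<and> p < 1 \<and> (\<forall>k.
            sqrt (prob_space.expectation M
               (\<lambda>\<omega>. (norm ((Xd k \<omega>, Ud k \<omega>) - (Xb k \<omega>, Ub k \<omega>)))\<^sup>2)) \<le> \<beta> * p ^ k))
       \<and> (\<forall>\<epsilon>>0. measure M (limsup (\<lambda>k. {\<omega> \<in> space M.
             norm ((Xd k \<omega>, Ud k \<omega>) - (Xb k \<omega>, Ub k \<omega>)) \<ge> \<epsilon>})) = 0)"
proof -
  interpret prob_space M
    by (rule M)
  define m where "m = expectation (W 0)"
  obtain C p where Cp: "0 \<le> C" "0 < p" "p < 1"
    "\<And>k x. norm (mat_pow (A + B ** K) k *v x) \<le> C * p ^ k * norm x"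
    using schur_stable_mat_pow_decay[OF P_stabilizing] by blast
  have "AE \<omega> in M. Ub k \<omega> = K *v Xb k \<omega> + F *v m" for k
    using measurable_Pair[OF Xb_rv(1,2)[of k]] Xb_law[of k, folded m_def]
    by (intro AE_feedback_if_distr_eq_mu_diamond) (simp_all add: borel_prod)
  then have "AE \<omega> in M. \<forall>k. Ub k \<omega> = K *v Xb k \<omega> + F *v m"
    by (simp add: AE_all_countable)
  then have deviation: "AE \<omega> in M. \<forall>k. norm ((Xd k \<omega>, Ud k \<omega>) - (Xb k \<omega>, Ub k \<omega>))
      \<le> (1 + onorm ((*v) K)) * C * p ^ k * norm (Xd 0 \<omega> - Xb 0 \<omega>)"
  proof eventually_elim
    case (elim \<omega>)
    then have "Ud k \<omega> - Ub k \<omega> = K *v (Xd k \<omega> - Xb k \<omega>)" for k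
      by (simp add: Ud m_def matrix_vector_mult_diff_distrib)
    from closed_loop_deviation_le[where x = "\<lambda>k. Xd k \<omega>" and y = "\<lambda>k. Xb k \<omega>"
        and u = "\<lambda>k. Ud k \<omega>" and v = "\<lambda>k. Ub k \<omega>", OF Xd Xb this Cp(4)]
    show ?case
      by blast
  qed
  have "integrable M (\<lambda>\<omega>. (norm (Xd 0 \<omega> - Xb 0 \<omega>))\<^sup>2)"
    unfolding Xd0 using X_ini_rv Xb_rv(1) X_ini_L2 Xb_L2(1) by (rule integrable_power2_norm_diff)
  moreover have "0 \<le> (1 + onorm ((*v) K)) * C"
    using Cp(1) onorm_pos_le[OF matrix_vector_mul_bounded_linear, of K] by simp
  ultimately show ?thesis
    using L2_and_limsup_of_geometric_bound[OF _ deviation _ less_imp_le[OF Cp(2)] Cp(3)] by blast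
qed

end
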